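(* Let $G$ be any infinite, locally finite, connected graph. If $G$ has a vertex $x_0$ such that $M(r)=\max_{x\in S_r(x_0)}m(x)$ satisfies $$\sum_{r=0}^{\infty}\frac{1}{M(r)}=\infty,$$ then $G$ is stochastically complete.
   Context: $d(x,y)$ is the number of edges in a shortest path from $x$ to $y$, $m(x)$ is the valence (number of edges at $x$), $y\sim x$ means $x,y$ are joined by an edge, and $S_r(x_0)=\{x: d(x,x_0)=r\}$. The combinatorial Laplacian is $\Delta f(x)=\sum_{y\sim x}(f(x)-f(y))$. The heat kernel $p_t(x,y)$ of a graph with vertex set $V$ is the smallest non-negative function on $V\times V\times[0,\infty)$ which is smooth in $t$, satisfies $\Delta p+\frac{\partial p}{\partial t}=0$ (with $\Delta$ in either vertex variable) and $p_0(x,y)=\delta_x(y)$. The graph is stochastically incomplete if $\sum_{y\in V}p_{t_0}(x_0,y)<1$ for some vertex $x_0$ and some $t_0>0$, and stochastically complete otherwise. *)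

theory Defs
  imports "HOL-Analysis.Analysis"
begin

definition simple_graph :: "'a set \<Rightarrow> 'a set set \<Rightarrow> bool" where
  "simple_graph V E \<longleftrightarrow> (\<forall>e\<in>E. e \<subseteq> V \<and> card e = 2)"

definition adjacent :: "'a set set \<Rightarrow> 'a \<Rightarrow> 'a \<Rightarrow> bool" where
  "adjacent E x y \<longleftrightarrow> {x, y} \<in> E"

definition locally_finite_graph :: "'a set \<Rightarrow> 'a set set \<Rightarrow> bool" where
  "locally_finite_graph V E \<longleftrightarrow> (\<forall>x\<in>V. finite {e \<in> E. x \<in> e})"

definition valence :: "'a set set \<Rightarrow> 'a \<Rightarrow> nat" where
  "valence E x = card {e \<in> E. x \<in> e}"

definition path_between :: "'a set \<Rightarrow> 'a set set \<Rightarrow> 'a \<Rightarrow> 'a \<Rightarrow> 'a list \<Rightarrow> bool" where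
  "path_between V E x y xs \<longleftrightarrow>
     xs \<noteq> [] \<and> set xs \<subseteq> V \<and> successively (adjacent E) xs \<and> hd xs = x \<and> last xs = y"

definition connected_graph :: "'a set \<Rightarrow> 'a set set \<Rightarrow> bool" where
  "connected_graph V E \<longleftrightarrow> (\<forall>x\<in>V. \<forall>y\<in>V. \<exists>xs. path_between V E x y xs)"

(* A path listed by its n + 1 vertices has n edges. *)
definition graph_dist :: "'a set \<Rightarrow> 'a set set \<Rightarrow> 'a \<Rightarrow> 'a \<Rightarrow> nat" where
  "graph_dist V E x y = (LEAST n. \<exists>xs. path_between V E x y xs \<and> length xs = Suc n)"

definition graph_sphere :: "'a set \<Rightarrow> 'a set set \<Rightarrow> 'a \<Rightarrow> nat \<Rightarrow> 'a set" where
  "graph_sphere V E x0 r = {x \<in> V. graph_dist V E x x0 = r}"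

(* In an infinite, locally finite, connected graph every sphere is finite and nonempty and
   every valence is positive, so Max is meaningful and the value is at least 1. *)
definition max_valence :: "'a set \<Rightarrow> 'a set set \<Rightarrow> 'a \<Rightarrow> nat \<Rightarrow> nat" where
  "max_valence V E x0 r = Max (valence E ` graph_sphere V E x0 r)"

definition laplacian :: "'a set set \<Rightarrow> ('a \<Rightarrow> real) \<Rightarrow> 'a \<Rightarrow> real" where
  "laplacian E f x = (\<Sum>y\<in>{y. adjacent E x y}. f x - f y)"

(* D n is the n-th derivative, one-sided at 0; values of f at negative arguments are irrelevant. *)
definition smooth_on_nonneg :: "(real \<Rightarrow> real) \<Rightarrow> bool" where
  "smooth_on_nonneg f \<longleftrightarrow>
     (\<exists>D :: nat \<Rightarrow> real \<Rightarrow> real. (\<forall>t\<ge>0. D 0 t = f t) \<and>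
        (\<forall>n. \<forall>t\<ge>0. (D n has_real_derivative D (Suc n) t) (at t within {0..})))"

(* The function value p_t(x,y) is written p t x y; only x, y in V and t \<ge> 0 are constrained.
   The last two conditions are the heat equation in the first and in the second variable. *)
definition heat_solution :: "'a set \<Rightarrow> 'a set set \<Rightarrow> (real \<Rightarrow> 'a \<Rightarrow> 'a \<Rightarrow> real) \<Rightarrow> bool" where
  "heat_solution V E p \<longleftrightarrow>
     (\<forall>x\<in>V. \<forall>y\<in>V.
        (\<forall>t\<ge>0. 0 \<le> p t x y) \<and>
        smooth_on_nonneg (\<lambda>t. p t x y) \<and>
        p 0 x y = (if x = y then 1 else 0) \<and>
        (\<forall>t\<ge>0. ((\<lambda>s. p s x y) has_real_derivative - laplacian E (\<lambda>z. p t z y) x)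
                  (at t within {0..})) \<and>
        (\<forall>t\<ge>0. ((\<lambda>s. p s x y) has_real_derivative - laplacian E (\<lambda>z. p t x z) y)
                  (at t within {0..})))"

definition is_heat_kernel :: "'a set \<Rightarrow> 'a set set \<Rightarrow> (real \<Rightarrow> 'a \<Rightarrow> 'a \<Rightarrow> real) \<Rightarrow> bool" where
  "is_heat_kernel V E p \<longleftrightarrow> heat_solution V E p \<and>
     (\<forall>q. heat_solution V E q \<longrightarrow> (\<forall>x\<in>V. \<forall>y\<in>V. \<forall>t\<ge>0. p t x y \<le> q t x y))"

(* Minimality determines the kernel on V, V and [0, \<infinity>); the choice only concerns the
   irrelevant values outside this domain. If no heat kernel existed, nothing could be derived
   about heat_kernel V E. *)
definition heat_kernel :: "'a set \<Rightarrow> 'a set set \<Rightarrow> real \<Rightarrow> 'a \<Rightarrow> 'a \<Rightarrow> real" where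
  "heat_kernel V E = (SOME p. is_heat_kernel V E p)"

(* Summation is in ennreal, where it is always defined: infsum over the reals would return 0
   for a divergent family. *)
definition stochastically_incomplete :: "'a set \<Rightarrow> 'a set set \<Rightarrow> bool" where
  "stochastically_incomplete V E \<longleftrightarrow>
     (\<exists>x0\<in>V. \<exists>t0>0. (\<Sum>\<^sub>\<infinity>y\<in>V. ennreal (heat_kernel V E t0 x0 y)) < 1)"

definition stochastically_complete :: "'a set \<Rightarrow> 'a set set \<Rightarrow> bool" where
  "stochastically_complete V E \<longleftrightarrow> \<not> stochastically_incomplete V E"

end

(* The heat kernel p is built by Feller's iteration: p is the increasing limit of the solutions of
   P_0 = 0, P_(n+1)' = - m(x) P_(n+1) + (sum of P_n over the neighbours of x).  The iterates have row
   sums at most 1 and lie below every heat solution, so p is the minimal one; it satisfies the equation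
   in the second variable because the iterates are symmetric.

   For completeness put phi(r) = (product over k < r of 1 + 1/M(k)), which tends to infinity by
   hypothesis and satisfies Delta phi(d(.,x0)) >= - phi(d(.,x0)).  Integrate p_t(x,.) against the
   finitely supported weight (1 - phi(d(.,x0))/phi(R))_+ to get F(t).  The forward equation and
   sum_y p_t(x,y) <= 1 give F' >= F - 1, so sum_y p_t(x,y) >= F(t) >= 1 - e^t phi(d(x,x0))/phi(R);
   let R tend to infinity. *)

theory Submission
  imports Defs
begin

section \<open>Variation of constants for a scalar linear equation\<close>

text \<open>The fundamental theorem of calculus is stated on compact intervals, the one-sided
  derivatives on \<open>{0..}\<close>; near \<open>t\<close> both filters agree.\<close>

lemma at_within_atLeast_0:
  fixes t :: real
  assumes "0 \<le> t"
  shows "at t within {0..} = at t within {0..t + 1}"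
  by (rule at_within_nhd[of _ "{..<t + 1}"]) (use assms in auto)

lemma continuous_on_atLeast_0I:
  fixes f :: "real \<Rightarrow> 'b::topological_space"
  assumes "\<And>b. continuous_on {0..b} f"
  shows "continuous_on {0..} f"
  unfolding continuous_on_eq_continuous_within
proof
  fix t :: real assume "t \<in> {0..}"
  with assms[of "t + 1"] show "continuous (at t within {0..}) f"
    by (simp add: at_within_atLeast_0 continuous_on_eq_continuous_within)
qed

lemma continuous_on_exp_mult:
  fixes g :: "real \<Rightarrow> real"
  assumes "continuous_on {0..} g"
  shows "continuous_on {0..t} (\<lambda>s. exp (m * s) * g s)"
  by (intro continuous_intros continuous_on_subset[OF assms]) auto

text \<open>Duhamel's formula: for continuous \<open>g\<close> and t \<ge> 0 it solves h' = g - m h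
  with h(0) = \<open>c\<close>. For \<open>c\<close> = 0 it inverts d/dt + m.\<close>

definition duhamel :: "real \<Rightarrow> real \<Rightarrow> (real \<Rightarrow> real) \<Rightarrow> real \<Rightarrow> real" where
  "duhamel m c g t = exp (- (m * t)) * (c + integral {0..t} (\<lambda>s. exp (m * s) * g s))"

lemma duhamel_0 [simp]: "duhamel m c g 0 = c"
  by (simp add: duhamel_def)

lemma has_real_derivative_duhamel:
  assumes g: "continuous_on {0..} g" and t: "0 \<le> t"
  shows "(duhamel m c g has_real_derivative g t - m * duhamel m c g t) (at t within {0..})"
proof -
  have "((\<lambda>t. integral {0..t} (\<lambda>s. exp (m * s) * g s)) has_real_derivative exp (m * t) * g t)
      (at t within {0..})"
    unfolding at_within_atLeast_0[OF t]
    by (rule integral_has_real_derivative[OF continuous_on_exp_mult[OF g]]) (use t in auto)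
  then have "((\<lambda>t. exp (- (m * t)) * (c + integral {0..t} (\<lambda>s. exp (m * s) * g s)))
      has_real_derivative (exp (- (m * t)) * (- m)) * (c + integral {0..t} (\<lambda>s. exp (m * s) * g s))
        + (exp (m * t) * g t) * exp (- (m * t))) (at t within {0..})"
    by (auto intro!: derivative_eq_intros)
  then show ?thesis
    unfolding duhamel_def by (rule DERIV_cong) (simp add: algebra_simps exp_minus)
qed

lemma continuous_on_duhamel:
  assumes "continuous_on {0..} g"
  shows "continuous_on {0..} (duhamel m c g)"
  using has_real_derivative_duhamel[OF assms]
  by (intro DERIV_continuous_on) auto

text \<open>The integrating factor \<open>exp (m * s)\<close> makes the equation exact.\<close>

lemma duhamel_unique:
  assumes h: "\<And>t. 0 \<le> t \<Longrightarrow> (h has_real_derivative g t - m * h t) (at t within {0..})"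
    and t: "0 \<le> t"
  shows "h t = duhamel m (h 0) g t"
proof -
  have "((\<lambda>s. exp (m * s) * h s) has_vector_derivative exp (m * s) * g s) (at s within {0..t})"
    if "s \<in> {0..t}" for s
  proof -
    have "(h has_real_derivative g s - m * h s) (at s within {0..t})"
      using that by (intro DERIV_subset[OF h]) auto
    then have "((\<lambda>s. exp (m * s) * h s) has_real_derivative
        (exp (m * s) * m) * h s + (g s - m * h s) * exp (m * s)) (at s within {0..t})"
      by (auto intro!: derivative_eq_intros)
    then show ?thesis
      unfolding has_real_derivative_iff_has_vector_derivative by (simp add: algebra_simps)
  qed
  then have "((\<lambda>s. exp (m * s) * g s) has_integral exp (m * t) * h t - exp (m * 0) * h 0) {0..t}"
    using t by (rule fundamental_theorem_of_calculus[rotated])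
  then show ?thesis
    by (simp add: duhamel_def integral_unique mult.assoc[symmetric] flip: exp_add)
qed

lemma duhamel_cong:
  assumes "\<And>s. 0 \<le> s \<Longrightarrow> g s = g' s"
  shows "duhamel m c g t = duhamel m c g' t"
proof -
  have "integral {0..t} (\<lambda>s. exp (m * s) * g s) = integral {0..t} (\<lambda>s. exp (m * s) * g' s)"
    by (rule integral_cong) (use assms in auto)
  then show ?thesis by (simp add: duhamel_def)
qed

lemma duhamel_mono:
  assumes "continuous_on {0..} g" "continuous_on {0..} g'" "c \<le> c'"
    and "\<And>s. 0 \<le> s \<Longrightarrow> g s \<le> g' s"
  shows "duhamel m c g t \<le> duhamel m c' g' t"
  unfolding duhamel_def
  by (intro mult_left_mono add_mono integral_le integrable_continuous_real continuous_on_exp_mult)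
    (use assms in auto)

lemma duhamel_zero [simp]: "duhamel m 0 (\<lambda>s. 0) t = 0"
  by (simp add: duhamel_def)

lemma duhamel_nonneg:
  assumes "continuous_on {0..} g" "0 \<le> c" "\<And>s. 0 \<le> s \<Longrightarrow> 0 \<le> g s"
  shows "0 \<le> duhamel m c g t"
  using duhamel_mono[of "\<lambda>s. 0" g 0 c m t] assms by simp

text \<open>The constant 1 solves h' = m - m h; this is the extremal case behind the row sum
  bound.\<close>

lemma duhamel_const: "0 \<le> t \<Longrightarrow> duhamel m 1 (\<lambda>s. m) t = 1"
  using duhamel_unique[of "\<lambda>s. 1" "\<lambda>s. m" m t] by simp

lemma duhamel_add:
  assumes "continuous_on {0..} g" "continuous_on {0..} g'"
  shows "duhamel m c g t + duhamel m c' g' t = duhamel m (c + c') (\<lambda>s. g s + g' s) t"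
  unfolding duhamel_def
  by (simp add: distrib_left integral_add integrable_continuous_real continuous_on_exp_mult assms)

lemma duhamel_sum:
  assumes "finite A" "\<And>i. i \<in> A \<Longrightarrow> continuous_on {0..} (g i)"
  shows "(\<Sum>i\<in>A. duhamel m (c i) (g i) t) = duhamel m (\<Sum>i\<in>A. c i) (\<lambda>s. \<Sum>i\<in>A. g i s) t"
  using assms
proof (induction A)
  case (insert i A)
  have "continuous_on {0..} (\<lambda>s. \<Sum>i\<in>A. g i s)"
    using insert.prems by (intro continuous_intros) auto
  with insert show ?case
    by (simp add: duhamel_add)
qed simp

text \<open>Both sides invert the product of d/dt + m and d/dt + k, and these factors
  commute.\<close>

lemma duhamel_commute:
  assumes g: "continuous_on {0..} g" and t: "0 \<le> t"
  shows "duhamel m 0 (duhamel k c g) t = duhamel k 0 (duhamel m c g) t"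
proof -
  define a where "a = duhamel k c g"
  define h where "h = duhamel m 0 a"
  \<comment> \<open>\<open>b\<close> is h' + k h. It satisfies b' + m b = g and b(0) =
    \<open>c\<close>, so it equals \<open>duhamel m c g\<close>; inverting d/dt + k then recovers
    \<open>h\<close>.\<close>
  define b where "b s = a s + (k - m) * h s" for s
  have a: "(a has_real_derivative g s - k * a s) (at s within {0..})" if "0 \<le> s" for s
    unfolding a_def by (rule has_real_derivative_duhamel[OF g that])
  have h: "(h has_real_derivative a s - m * h s) (at s within {0..})" if "0 \<le> s" for s
    unfolding h_def a_def
    by (rule has_real_derivative_duhamel[OF continuous_on_duhamel[OF g] that])
  have "(b has_real_derivative g s - m * b s) (at s within {0..})" if "0 \<le> s" for s
    unfolding b_def
    by (rule derivative_eq_intros a h that refl)+ (simp add: algebra_simps)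
  then have b: "b s = duhamel m c g s" if "0 \<le> s" for s
    using duhamel_unique[of b g m s] that by (simp add: b_def a_def h_def)
  have "(h has_real_derivative b s - k * h s) (at s within {0..})" if "0 \<le> s" for s
    using h[OF that] by (simp add: b_def algebra_simps)
  then have "h t = duhamel k 0 b t"
    using duhamel_unique[of h b k t] t by (simp add: h_def)
  also have "\<dots> = duhamel k 0 (duhamel m c g) t"
    by (rule duhamel_cong) (rule b)
  finally show ?thesis
    by (simp add: h_def a_def)
qed

section \<open>The minimal heat kernel\<close>

text \<open>For the walk that leaves each vertex at rate equal to its valence, iterate
  \<open>n\<close> is the probability of being at \<open>y\<close> at time \<open>t\<close> after
  fewer than \<open>n\<close> jumps; the recursion conditions on the first jump. Time comes last so
  that each entry is a function for \<open>duhamel\<close>.\<close>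

primrec heat_iter :: "'a set set \<Rightarrow> nat \<Rightarrow> 'a \<Rightarrow> 'a \<Rightarrow> real \<Rightarrow> real" where
  "heat_iter E 0 = (\<lambda>x y t. 0)"
| "heat_iter E (Suc n) = (\<lambda>x y. duhamel (real (valence E x)) (of_bool (x = y))
     (\<lambda>s. \<Sum>z | adjacent E x z. heat_iter E n z y s))"

declare heat_iter.simps(2) [simp del]

text \<open>\<open>lim\<close> is meaningful for t \<ge> 0, where the iterates increase and are
  bounded. The argument order is that of \<open>heat_solution\<close>.\<close>

definition minimal_kernel :: "'a set set \<Rightarrow> real \<Rightarrow> 'a \<Rightarrow> 'a \<Rightarrow> real" where
  "minimal_kernel E t x y = lim (\<lambda>n. heat_iter E n x y t)"

lemma adjacent_commute: "adjacent E x y \<longleftrightarrow> adjacent E y x"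
  by (simp add: adjacent_def insert_commute)

locale locally_finite_simple_graph =
  fixes V :: "'a set" and E :: "'a set set"
  assumes simple: "simple_graph V E" and locally_finite: "locally_finite_graph V E"
begin

section \<open>Neighbours and valence\<close>

lemma adjacent_in_V:
  assumes "adjacent E x y"
  shows "x \<in> V" "y \<in> V"
  using assms simple by (auto simp: adjacent_def simple_graph_def)

lemma finite_edges_at: "finite {e \<in> E. x \<in> e}"
proof (cases "x \<in> V")
  case True
  then show ?thesis
    using locally_finite by (simp add: locally_finite_graph_def)
next
  case False
  then have "{e \<in> E. x \<in> e} = {}"
    using simple by (auto simp: simple_graph_def)
  then show ?thesis by (simp only: finite.emptyI)
qed

text \<open>An edge at \<open>x\<close> is determined by its other end, so finiteness and counting
  pass from edges to neighbours.\<close>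

lemma edges_at_eq: "{e \<in> E. x \<in> e} = (\<lambda>y. {x, y}) ` {y. adjacent E x y}"
proof -
  have "\<exists>y. e = {x, y}" if "e \<in> E" "x \<in> e" for e
    using simple that by (fastforce simp: simple_graph_def card_2_iff)
  then show ?thesis
    by (auto simp: adjacent_def image_iff)
qed

lemma inj_edge: "inj_on (\<lambda>y. {x, y}) A"
  by (auto simp: inj_on_def doubleton_eq_iff)

lemma finite_nbrs [simp]: "finite {y. adjacent E x y}"
  using finite_edges_at[of x] unfolding edges_at_eq by (simp add: finite_image_iff inj_edge)

lemma card_nbrs: "card {y. adjacent E x y} = valence E x"
  unfolding valence_def edges_at_eq by (simp add: card_image inj_edge)

text \<open>Isolates the diagonal term: the heat equation at \<open>x\<close> becomes a scalar
  linear equation with the neighbour sum as forcing.\<close>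

lemma laplacian_eq:
  "laplacian E f x = real (valence E x) * f x - (\<Sum>y | adjacent E x y. f y)"
  by (simp add: laplacian_def sum_subtractf card_nbrs)

section \<open>Estimates and symmetry of the iterates\<close>

lemma continuous_on_heat_iter: "continuous_on {0..} (heat_iter E n x y)"
  by (induction n arbitrary: x)
    (auto simp: heat_iter.simps(2) intro!: continuous_on_duhamel continuous_intros)

lemma continuous_on_sum_heat_iter: "continuous_on {0..} (\<lambda>s. \<Sum>z\<in>A. heat_iter E n (f z) (g z) s)"
  by (intro continuous_intros continuous_on_heat_iter)

lemma heat_iter_nonneg: "0 \<le> t \<Longrightarrow> 0 \<le> heat_iter E n x y t"
  by (induction n arbitrary: x t)
    (auto simp: heat_iter.simps(2) intro!: duhamel_nonneg sum_nonneg continuous_on_sum_heat_iter)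

text \<open>The recursion preserves order, and iterate 0 lies below iterate 1.\<close>

lemma heat_iter_mono: "0 \<le> t \<Longrightarrow> heat_iter E n x y t \<le> heat_iter E (Suc n) x y t"
proof (induction n arbitrary: x t)
  case 0
  then show ?case using heat_iter_nonneg[of t "Suc 0" x y] by simp
next
  case (Suc n)
  have "duhamel (real (valence E x)) (of_bool (x = y))
        (\<lambda>s. \<Sum>z | adjacent E x z. heat_iter E n z y s) t
      \<le> duhamel (real (valence E x)) (of_bool (x = y))
        (\<lambda>s. \<Sum>z | adjacent E x z. heat_iter E (Suc n) z y s) t"
    by (intro duhamel_mono continuous_on_sum_heat_iter sum_mono Suc.IH) auto
  then show ?case
    by (simp only: heat_iter.simps(2))
qed

text \<open>Summed over \<open>B\<close>, the recursion has initial value at most 1 and, by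
  induction, forcing at most \<open>valence E x\<close>; the constant solution 1 dominates
  it.\<close>

lemma sum_heat_iter_le_1:
  assumes "finite B" "0 \<le> t"
  shows "(\<Sum>y\<in>B. heat_iter E n x y t) \<le> 1"
  using \<open>0 \<le> t\<close>
proof (induction n arbitrary: x t)
  case (Suc n)
  have "(\<Sum>y\<in>B. heat_iter E (Suc n) x y t)
      = duhamel (real (valence E x)) (\<Sum>y\<in>B. of_bool (x = y))
          (\<lambda>s. \<Sum>y\<in>B. \<Sum>z | adjacent E x z. heat_iter E n z y s) t"
    unfolding heat_iter.simps(2)
    by (rule duhamel_sum) (auto intro: assms continuous_on_sum_heat_iter)
  also have "\<dots> \<le> duhamel (real (valence E x)) 1 (\<lambda>s. real (valence E x)) t"
  proof (rule duhamel_mono)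
    show "(\<Sum>y\<in>B. of_bool (x = y)) \<le> (1::real)"
      using \<open>finite B\<close> by (simp add: of_bool_def)
    fix s :: real assume "0 \<le> s"
    have "(\<Sum>y\<in>B. \<Sum>z | adjacent E x z. heat_iter E n z y s)
        = (\<Sum>z | adjacent E x z. \<Sum>y\<in>B. heat_iter E n z y s)"
      by (rule sum.swap)
    also have "\<dots> \<le> (\<Sum>z | adjacent E x z. 1)"
      by (rule sum_mono) (rule Suc.IH[OF \<open>0 \<le> s\<close>])
    finally show "(\<Sum>y\<in>B. \<Sum>z | adjacent E x z. heat_iter E n z y s) \<le> real (valence E x)"
      by (simp add: card_nbrs)
  qed (intro continuous_intros continuous_on_heat_iter)+
  also have "\<dots> = 1"
    using Suc.prems by (rule duhamel_const)
  finally show ?case .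
qed simp

lemma heat_iter_le_1: "0 \<le> t \<Longrightarrow> heat_iter E n x y t \<le> 1"
  using sum_heat_iter_le_1[of "{y}"] by simp

text \<open>The two recursions agree because the resolvents \<open>duhamel m 0\<close> commute.\<close>
lemma heat_iter_forward:
  assumes "0 \<le> t"
  shows "heat_iter E (Suc n) x y t = duhamel (real (valence E y)) (of_bool (x = y))
     (\<lambda>s. \<Sum>w | adjacent E y w. heat_iter E n x w s) t"
  using assms
proof (induction n arbitrary: x y t)
  case 0
  then show ?case by (cases "x = y") (auto simp: heat_iter.simps(2))
next
  case (Suc n)
  let ?m = "\<lambda>x. real (valence E x)"
  \<comment> \<open>\<open>c\<close> is the initial value of the inner neighbour sums and
    \<open>K\<close> moves one step from each end; both recursions, unfolded twice, lead to these
    data.\<close>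
  define c :: real where "c = of_bool (adjacent E x y)"
  define K where "K s = (\<Sum>z | adjacent E x z. \<Sum>w | adjacent E y w. heat_iter E n z w s)" for s
  have K: "continuous_on {0..} K"
    unfolding K_def by (intro continuous_intros continuous_on_heat_iter)
  \<comment> \<open>\<open>duhamel_commute\<close> has outer initial value 0, so the homogeneous
    part is split off.\<close>
  have split: "duhamel m d (duhamel k c K) t = duhamel m d (\<lambda>s. 0) t + duhamel m 0 (duhamel k c K) t"
    for m d k
    by (simp add: duhamel_add continuous_on_duhamel[OF K])
  have "heat_iter E (Suc (Suc n)) x y t
      = duhamel (?m x) (of_bool (x = y)) (\<lambda>s. \<Sum>z | adjacent E x z. heat_iter E (Suc n) z y s) t"
    by (subst heat_iter.simps(2)) (rule refl)
  also have "\<dots> = duhamel (?m x) (of_bool (x = y)) (duhamel (?m y) c K) t"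
  proof (rule duhamel_cong)
    fix s :: real assume "0 \<le> s"
    have "(\<Sum>z | adjacent E x z. heat_iter E (Suc n) z y s)
        = (\<Sum>z | adjacent E x z. duhamel (?m y) (of_bool (z = y))
            (\<lambda>s. \<Sum>w | adjacent E y w. heat_iter E n z w s) s)"
      by (rule sum.cong[OF refl]) (rule Suc.IH[OF \<open>0 \<le> s\<close>])
    also have "\<dots> = duhamel (?m y) (\<Sum>z | adjacent E x z. of_bool (z = y)) K s"
      unfolding K_def by (rule duhamel_sum) (auto intro: continuous_on_sum_heat_iter)
    also have "(\<Sum>z | adjacent E x z. of_bool (z = y)) = c"
      by (simp add: c_def of_bool_def)
    finally show "(\<Sum>z | adjacent E x z. heat_iter E (Suc n) z y s) = duhamel (?m y) c K s" .
  qed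
  \<comment> \<open>The homogeneous parts agree: for x = y the two rates coincide, otherwise the
    initial value is 0.\<close>
  also have "\<dots> = duhamel (?m y) (of_bool (x = y)) (duhamel (?m x) c K) t"
    unfolding split[of _ "of_bool (x = y)"] duhamel_commute[OF K \<open>0 \<le> t\<close>, of "?m x" "?m y"]
    by (cases "x = y") auto
  also have "\<dots> = duhamel (?m y) (of_bool (x = y))
      (\<lambda>s. \<Sum>w | adjacent E y w. heat_iter E (Suc n) x w s) t"
  proof (rule duhamel_cong)
    fix s :: real
    have "(\<Sum>w | adjacent E y w. heat_iter E (Suc n) x w s)
        = duhamel (?m x) (\<Sum>w | adjacent E y w. of_bool (x = w))
           (\<lambda>s. \<Sum>w | adjacent E y w. \<Sum>z | adjacent E x z. heat_iter E n z w s) s"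
      unfolding heat_iter.simps(2)
      by (rule duhamel_sum) (auto intro: continuous_on_sum_heat_iter)
    also have "(\<lambda>s. \<Sum>w | adjacent E y w. \<Sum>z | adjacent E x z. heat_iter E n z w s) = K"
      unfolding K_def by (intro ext sum.swap)
    also have "(\<Sum>w | adjacent E y w. of_bool (x = w)) = c"
      by (simp add: c_def of_bool_def adjacent_commute[of E x y])
    finally show "duhamel (?m x) c K s = (\<Sum>w | adjacent E y w. heat_iter E (Suc n) x w s)" ..
  qed
  finally show ?case .
qed

text \<open>Exchanging \<open>x\<close> and \<open>y\<close> turns the forward recursion into the
  defining one.\<close>

lemma heat_iter_commute: "0 \<le> t \<Longrightarrow> heat_iter E n x y t = heat_iter E n y x t"
proof (induction n arbitrary: x y t)
  case (Suc n)
  have "heat_iter E (Suc n) x y t = duhamel (real (valence E y)) (of_bool (x = y))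
     (\<lambda>s. \<Sum>w | adjacent E y w. heat_iter E n x w s) t"
    by (rule heat_iter_forward[OF Suc.prems])
  also have "\<dots> = duhamel (real (valence E y)) (of_bool (y = x))
     (\<lambda>s. \<Sum>w | adjacent E y w. heat_iter E n w x s) t"
    unfolding eq_commute[of x y] by (intro duhamel_cong sum.cong Suc.IH refl)
  finally show ?case
    by (simp add: heat_iter.simps(2))
qed simp

section \<open>Passage to the limit\<close>

lemma heat_iter_tendsto:
  assumes "0 \<le> t"
  shows "(\<lambda>n. heat_iter E n x y t) \<longlonglongrightarrow> minimal_kernel E t x y"
proof -
  have "monoseq (\<lambda>n. heat_iter E n x y t)"
    using heat_iter_mono[OF assms] by (intro mono_SucI1) auto
  moreover have "Bseq (\<lambda>n. heat_iter E n x y t)"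
    using heat_iter_nonneg[OF assms] heat_iter_le_1[OF assms] by (intro BseqI'[of _ 1]) auto
  ultimately show ?thesis
    unfolding minimal_kernel_def by (intro convergent_LIMSEQ_iff[THEN iffD1] Bseq_monoseq_convergent)
qed

lemma minimal_kernel_nonneg: "0 \<le> t \<Longrightarrow> 0 \<le> minimal_kernel E t x y"
  by (rule LIMSEQ_le_const[OF heat_iter_tendsto]) (auto intro: heat_iter_nonneg)

lemma minimal_kernel_commute: "0 \<le> t \<Longrightarrow> minimal_kernel E t x y = minimal_kernel E t y x"
  unfolding minimal_kernel_def by (simp only: heat_iter_commute[of t _ x y])

lemma sum_minimal_kernel_le_1:
  assumes "finite B" "0 \<le> t"
  shows "(\<Sum>y\<in>B. minimal_kernel E t x y) \<le> 1"
  by (rule LIMSEQ_le_const2[OF tendsto_sum[OF heat_iter_tendsto]])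
    (use assms sum_heat_iter_le_1 in auto)

text \<open>Dominated convergence carries the recursion to the limit and also yields integrability,
  before continuity of the limit is known.\<close>

lemma
  assumes "0 \<le> t"
  shows minimal_kernel_integrable:
      "(\<lambda>s. exp (real (valence E x) * s) * (\<Sum>z | adjacent E x z. minimal_kernel E s z y))
        integrable_on {0..t}"
    and minimal_kernel_eq_duhamel:
      "minimal_kernel E t x y = duhamel (real (valence E x)) (of_bool (x = y))
        (\<lambda>s. \<Sum>z | adjacent E x z. minimal_kernel E s z y) t"
proof -
  let ?m = "real (valence E x)"
  let ?g = "\<lambda>s. exp (?m * s) * (\<Sum>z | adjacent E x z. minimal_kernel E s z y)"
  let ?f = "\<lambda>n s. exp (?m * s) * (\<Sum>z | adjacent E x z. heat_iter E n z y s)"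
  have int: "?f n integrable_on {0..t}" for n
    by (intro integrable_continuous_real continuous_on_exp_mult continuous_on_sum_heat_iter)
  have int': "(\<lambda>s. exp (?m * s) * ?m) integrable_on {0..t}"
    by (intro integrable_continuous_real continuous_intros)
  have dom: "norm (?f n s) \<le> exp (?m * s) * ?m" if "s \<in> {0..t}" for n s
  proof -
    have "(\<Sum>z | adjacent E x z. heat_iter E n z y s) \<le> (\<Sum>z | adjacent E x z. 1)"
      using that by (intro sum_mono heat_iter_le_1) auto
    moreover have "0 \<le> (\<Sum>z | adjacent E x z. heat_iter E n z y s)"
      using that by (intro sum_nonneg heat_iter_nonneg) auto
    ultimately show ?thesis
      by (simp add: card_nbrs abs_mult)
  qed
  have lim: "(\<lambda>n. ?f n s) \<longlonglongrightarrow> ?g s" if "s \<in> {0..t}" for s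
    using that by (intro tendsto_intros heat_iter_tendsto) auto
  note dc = dominated_convergence[OF int int' dom lim]
  from dc(1) show "?g integrable_on {0..t}" .
  have "(\<lambda>n. heat_iter E (Suc n) x y t)
      \<longlonglongrightarrow> duhamel ?m (of_bool (x = y)) (\<lambda>s. \<Sum>z | adjacent E x z. minimal_kernel E s z y) t"
    unfolding heat_iter.simps(2) duhamel_def by (intro tendsto_intros dc(2))
  moreover have "(\<lambda>n. heat_iter E (Suc n) x y t) \<longlonglongrightarrow> minimal_kernel E t x y"
    using heat_iter_tendsto[OF assms] by (rule LIMSEQ_Suc)
  ultimately show "minimal_kernel E t x y = duhamel ?m (of_bool (x = y))
        (\<lambda>s. \<Sum>z | adjacent E x z. minimal_kernel E s z y) t"
    by (rule LIMSEQ_unique[rotated])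
qed

text \<open>The indefinite integral of a merely integrable function is continuous, so the
  fixed-point equation gains regularity.\<close>

lemma continuous_on_minimal_kernel: "continuous_on {0..} (\<lambda>t. minimal_kernel E t x y)"
proof (rule continuous_on_atLeast_0I)
  fix b :: real
  show "continuous_on {0..b} (\<lambda>t. minimal_kernel E t x y)"
  proof (cases "0 \<le> b")
    case True
    have "continuous_on {0..b} (duhamel (real (valence E x)) (of_bool (x = y))
        (\<lambda>s. \<Sum>z | adjacent E x z. minimal_kernel E s z y))"
      unfolding duhamel_def
      by (intro continuous_intros indefinite_integral_continuous_1 minimal_kernel_integrable True)
    then show ?thesis
      by (rule continuous_on_eq) (auto simp: minimal_kernel_eq_duhamel[symmetric])
  qed simp
qed

lemma minimal_kernel_0: "minimal_kernel E 0 x y = of_bool (x = y)"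
  by (simp add: minimal_kernel_eq_duhamel)

text \<open>The forcing is now known to be continuous, so Duhamel's formula can be
  differentiated.\<close>

lemma minimal_kernel_backward:
  assumes "0 \<le> t"
  shows "((\<lambda>s. minimal_kernel E s x y) has_real_derivative
    - laplacian E (\<lambda>z. minimal_kernel E t z y) x) (at t within {0..})"
proof -
  let ?D = "duhamel (real (valence E x)) (of_bool (x = y))
        (\<lambda>s. \<Sum>z | adjacent E x z. minimal_kernel E s z y)"
  have "(?D has_real_derivative (\<Sum>z | adjacent E x z. minimal_kernel E t z y)
      - real (valence E x) * ?D t) (at t within {0..})"
    by (intro has_real_derivative_duhamel assms continuous_intros continuous_on_minimal_kernel)
  then have "(?D has_real_derivative - laplacian E (\<lambda>z. minimal_kernel E t z y) x)
      (at t within {0..})"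
    using assms by (simp add: laplacian_eq flip: minimal_kernel_eq_duhamel)
  then show ?thesis
    by (rule has_field_derivative_transform_within[OF _ zero_less_one])
      (use assms in \<open>auto simp: minimal_kernel_eq_duhamel[symmetric]\<close>)
qed

text \<open>Symmetry of the kernel exchanges the two variables of the backward equation.\<close>

lemma minimal_kernel_forward:
  assumes "0 \<le> t"
  shows "((\<lambda>s. minimal_kernel E s x y) has_real_derivative
    - laplacian E (\<lambda>z. minimal_kernel E t x z) y) (at t within {0..})"
proof -
  have "((\<lambda>s. minimal_kernel E s y x) has_real_derivative
      - laplacian E (\<lambda>z. minimal_kernel E t x z) y) (at t within {0..})"
    using minimal_kernel_backward[OF assms, of y x] assms
    by (simp add: minimal_kernel_commute[of t x])
  then show ?thesis
    by (rule has_field_derivative_transform_within[OF _ zero_less_one])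
      (use assms in \<open>auto simp: minimal_kernel_commute[of _ x]\<close>)
qed

lemma smooth_minimal_kernel: "smooth_on_nonneg (\<lambda>t. minimal_kernel E t x y)"
proof -
  \<comment> \<open>The n-th time derivative is the n-th power of the negative Laplacian in the
    first variable; neighbour sums are finite and can be differentiated termwise.\<close>
  define D where "D n t = ((\<lambda>f z. - laplacian E f z) ^^ n) (\<lambda>z. minimal_kernel E t z y)" for n t
  have D0: "D 0 t x = minimal_kernel E t x y" for t x
    by (simp add: D_def)
  have DS: "D (Suc n) t x = - laplacian E (D n t) x" for n t x
    by (simp add: D_def)
  have "((\<lambda>t. D n t x) has_real_derivative D (Suc n) t x) (at t within {0..})" if "0 \<le> t" for n t x
  proof (induction n arbitrary: x)
    case 0
    then show ?case
      using minimal_kernel_backward[OF that] by (simp add: D_def)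
  next
    case (Suc n)
    have "((\<lambda>t. - (\<Sum>y | adjacent E x y. D n t x - D n t y)) has_real_derivative
        - (\<Sum>y | adjacent E x y. D (Suc n) t x - D (Suc n) t y)) (at t within {0..})"
      by (intro DERIV_minus DERIV_sum DERIV_diff Suc.IH)
    then show ?case
      by (simp only: DS laplacian_def)
  qed
  then show ?thesis
    unfolding smooth_on_nonneg_def by (intro exI[of _ "\<lambda>n t. D n t x"]) (simp add: D0)
qed

section \<open>Identification with the heat kernel\<close>

lemma heat_solution_minimal_kernel: "heat_solution V E (minimal_kernel E)"
  unfolding heat_solution_def
  by (auto simp: minimal_kernel_nonneg smooth_minimal_kernel minimal_kernel_0
      intro: minimal_kernel_backward minimal_kernel_forward)

text \<open>A heat solution is a fixed point of the monotone recursion by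
  \<open>duhamel_unique\<close>, and iterate 0 lies below it.\<close>

lemma heat_iter_le_heat_solution:
  assumes q: "heat_solution V E q" and "x \<in> V" "y \<in> V" "0 \<le> t"
  shows "heat_iter E n x y t \<le> q t x y"
  using \<open>x \<in> V\<close> \<open>0 \<le> t\<close>
proof (induction n arbitrary: x t)
  case 0
  then show ?case
    using q \<open>y \<in> V\<close> by (simp add: heat_solution_def)
next
  case (Suc n)
  let ?g = "\<lambda>s. \<Sum>z | adjacent E x z. q s z y"
  have der: "((\<lambda>s. q s x y) has_real_derivative - laplacian E (\<lambda>z. q t z y) x) (at t within {0..})"
    if "x \<in> V" "0 \<le> t" for x t
    using q that \<open>y \<in> V\<close> by (auto simp: heat_solution_def)
  have "continuous_on {0..} (\<lambda>s. q s x y)" if "x \<in> V" for x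
    by (rule DERIV_continuous_on) (rule der, use that in auto)
  then have cont: "continuous_on {0..} ?g"
    by (intro continuous_intros) (auto dest: adjacent_in_V)
  have "heat_iter E (Suc n) x y t \<le> duhamel (real (valence E x)) (of_bool (x = y)) ?g t"
    unfolding heat_iter.simps(2)
    by (intro duhamel_mono cont continuous_on_sum_heat_iter sum_mono Suc.IH)
      (auto dest: adjacent_in_V)
  also have "\<dots> = q t x y"
  proof -
    have "q t x y = duhamel (real (valence E x)) (q 0 x y) ?g t"
      by (rule duhamel_unique) (use der Suc.prems in \<open>auto simp: laplacian_eq\<close>)
    moreover have "q 0 x y = of_bool (x = y)"
      using q Suc.prems \<open>y \<in> V\<close> by (simp add: heat_solution_def)
    ultimately show ?thesis by simp
  qed
  finally show ?case .
qed

lemma is_heat_kernel_minimal_kernel: "is_heat_kernel V E (minimal_kernel E)"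
  unfolding is_heat_kernel_def
  by (auto simp: heat_solution_minimal_kernel
      intro!: LIMSEQ_le_const2[OF heat_iter_tendsto] heat_iter_le_heat_solution)

text \<open>\<open>SOME\<close> picks a genuine heat kernel because one exists; minimality of both
  kernels bounds each by the other.\<close>

lemma heat_kernel_eq_minimal_kernel:
  assumes "x \<in> V" "y \<in> V" "0 \<le> t"
  shows "heat_kernel V E t x y = minimal_kernel E t x y"
proof -
  have "is_heat_kernel V E (heat_kernel V E)"
    unfolding heat_kernel_def by (rule someI[of "is_heat_kernel V E"]) (rule is_heat_kernel_minimal_kernel)
  with is_heat_kernel_minimal_kernel assms show ?thesis
    unfolding is_heat_kernel_def by (intro antisym) blast+
qed

end

section \<open>Completeness from the valence growth\<close>

locale rooted_connected_graph = locally_finite_simple_graph +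
  fixes x0 :: 'a
  assumes connected: "connected_graph V E" and root: "x0 \<in> V"
begin

section \<open>Distance from the root\<close>

abbreviation depth :: "'a \<Rightarrow> nat" where
  "depth x \<equiv> graph_dist V E x x0"

lemma depth_le:
  assumes "path_between V E y x0 xs" "length xs = Suc n"
  shows "depth y \<le> n"
  unfolding graph_dist_def using assms by (intro Least_le) auto

lemma shortest_path:
  assumes "y \<in> V"
  shows "\<exists>xs. path_between V E y x0 xs \<and> length xs = Suc (depth y)"
proof -
  obtain xs where "path_between V E y x0 xs"
    using connected assms root by (auto simp: connected_graph_def)
  then have "path_between V E y x0 xs \<and> length xs = Suc (length xs - 1)"
    by (simp add: path_between_def)
  then have "\<exists>n xs. path_between V E y x0 xs \<and> length xs = Suc n"
    by blast
  then show ?thesis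
    unfolding graph_dist_def by (rule LeastI_ex)
qed

lemma depth_adjacent:
  assumes "adjacent E y z"
  shows "depth y \<le> Suc (depth z)"
proof -
  obtain xs where xs: "path_between V E z x0 xs" "length xs = Suc (depth z)"
    using shortest_path adjacent_in_V[OF assms] by blast
  then have "path_between V E y x0 (y # xs)"
    using assms adjacent_in_V[OF assms] by (auto simp: path_between_def successively_Cons)
  then show ?thesis
    by (rule depth_le) (simp add: xs)
qed

lemma depth_eq_0:
  assumes "y \<in> V" "depth y = 0"
  shows "y = x0"
proof -
  obtain xs where "path_between V E y x0 xs" "length xs = Suc 0"
    using shortest_path[OF assms(1)] assms(2) by auto
  then show ?thesis
    by (auto simp: path_between_def length_Suc_conv)
qed

text \<open>Deleting the first vertex of a shortest path gives depth at most \<open>n\<close>;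
  \<open>depth_adjacent\<close> excludes anything smaller.\<close>

lemma depth_Suc_predecessor:
  assumes "y \<in> V" "depth y = Suc n"
  shows "\<exists>z. adjacent E z y \<and> depth z = n"
proof -
  obtain xs where xs: "path_between V E y x0 xs" "length xs = Suc (Suc n)"
    using shortest_path[OF assms(1)] assms(2) by auto
  then obtain z zs where zs: "xs = y # z # zs" "length zs = n"
    by (auto simp: path_between_def length_Suc_conv)
  then have adj: "adjacent E y z" and "path_between V E z x0 (z # zs)"
    using xs by (auto simp: path_between_def)
  then have "depth z \<le> n"
    using zs by (intro depth_le) auto
  with depth_adjacent[OF adj] assms(2) have "depth z = n" by simp
  with adj show ?thesis by (auto simp: adjacent_commute)
qed

text \<open>Each sphere lies among the neighbours of the previous one. Finiteness makes
  \<open>Max\<close> in \<open>max_valence\<close> an upper bound.\<close>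

lemma finite_graph_sphere: "finite (graph_sphere V E x0 n)"
proof (induction n)
  case 0
  have "graph_sphere V E x0 0 \<subseteq> {x0}"
    by (auto simp: graph_sphere_def depth_eq_0)
  then show ?case by (rule finite_subset) simp
next
  case (Suc n)
  have "graph_sphere V E x0 (Suc n) \<subseteq> (\<Union>z\<in>graph_sphere V E x0 n. {y. adjacent E z y})"
    by (auto simp: graph_sphere_def dest!: depth_Suc_predecessor dest: adjacent_in_V)
  then show ?case
    by (rule finite_subset) (simp add: Suc.IH)
qed

lemma finite_ball: "finite {y \<in> V. depth y < R}"
proof -
  have "{y \<in> V. depth y < R} = (\<Union>n<R. graph_sphere V E x0 n)"
    by (auto simp: graph_sphere_def)
  then show ?thesis by (simp add: finite_graph_sphere)
qed

section \<open>The barrier built from the valence bound\<close>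

lemma valence_le_max_valence:
  assumes "x \<in> V"
  shows "valence E x \<le> max_valence V E x0 (depth x)"
  unfolding max_valence_def
  using assms by (intro Max_ge finite_imageI finite_graph_sphere) (auto simp: graph_sphere_def)

text \<open>Chosen so that the increment at \<open>r\<close> is \<open>barrier r\<close> divided by
  the maximal valence: that many outward edges lower the Laplacian by at most
  \<open>barrier r\<close>.\<close>

definition barrier :: "nat \<Rightarrow> real" where
  "barrier r = (\<Prod>k<r. 1 + 1 / real (max_valence V E x0 k))"

lemma barrier_Suc: "barrier (Suc r) = barrier r + barrier r / real (max_valence V E x0 r)"
  by (simp add: barrier_def algebra_simps)

lemma barrier_pos: "0 < barrier r"
  unfolding barrier_def by (intro prod_pos) (auto intro: add_pos_nonneg)

lemma barrier_mono: "r \<le> s \<Longrightarrow> barrier r \<le> barrier s"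
  by (rule lift_Suc_mono_le[of barrier])
    (simp_all add: barrier_Suc less_imp_le barrier_pos)

text \<open>The product dominates the partial sums of the reciprocals, which would be summable if it
  stayed bounded. The threshold \<open>N\<close> lets the ball contain a prescribed vertex.\<close>

lemma barrier_unbounded:
  assumes "(\<Sum>r. ennreal (1 / real (max_valence V E x0 r))) = \<infinity>"
  shows "\<exists>R\<ge>N. C < barrier R"
proof (rule ccontr)
  assume neg: "\<not> ?thesis"
  let ?a = "\<lambda>r. 1 / real (max_valence V E x0 r)"
  have "(\<Sum>r<R. ?a r) \<le> C" for R
  proof -
    have "(\<Sum>r<R. ?a r) \<le> barrier R"
      unfolding barrier_def by (rule sum_le_prod) simp
    \<comment> \<open>The negated claim bounds \<open>barrier\<close> only from radius
      \<open>N\<close> on; monotonicity covers smaller radii.\<close>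
    also have "\<dots> \<le> barrier (max N R)"
      by (rule barrier_mono) simp
    also have "\<dots> \<le> C"
      using neg by (meson max.cobounded1 not_less)
    finally show ?thesis .
  qed
  then have "summable ?a"
    by (intro summableI_nonneg_bounded[of _ C]) auto
  then have "(\<Sum>r. ennreal (?a r)) = ennreal (\<Sum>r. ?a r)"
    by (intro suminf_ennreal2) auto
  with assms show False by simp
qed

text \<open>A neighbour is at most one step further out, so each edge contributes at least minus one
  increment.\<close>

lemma laplacian_barrier:
  assumes "y \<in> V"
  shows "- barrier (depth y) \<le> laplacian E (\<lambda>z. barrier (depth z)) y"
proof -
  let ?M = "max_valence V E x0 (depth y)"
  have "(\<Sum>z | adjacent E y z. - (barrier (depth y) / real ?M))
      \<le> laplacian E (\<lambda>z. barrier (depth z)) y"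
    unfolding laplacian_def
  proof (rule sum_mono)
    fix z assume "z \<in> {z. adjacent E y z}"
    then have "barrier (depth z) \<le> barrier (Suc (depth y))"
      by (intro barrier_mono depth_adjacent) (simp add: adjacent_commute)
    then show "- (barrier (depth y) / real ?M) \<le> barrier (depth y) - barrier (depth z)"
      by (simp add: barrier_Suc)
  qed
  moreover have "real (valence E y) * (barrier (depth y) / real ?M) \<le> barrier (depth y)"
  \<comment> \<open>If \<open>?M\<close> is 0, the quotient is 0 by convention.\<close>
  proof (cases "?M = 0")
    case False
    have "real (valence E y) * barrier (depth y) \<le> real ?M * barrier (depth y)"
      using valence_le_max_valence[OF assms] barrier_pos[of "depth y"] by (intro mult_right_mono) auto
    with False show ?thesis by (simp add: field_simps)
  qed (simp add: less_imp_le barrier_pos)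
  ultimately show ?thesis
    by (simp add: card_nbrs)
qed

text \<open>The weight \<open>1 - barrier (depth y) / barrier R\<close> vanishes on the sphere of radius \<open>R\<close>, so
  it is its own extension by zero up to that sphere, and dropping the edges that leave the ball only
  loses nonnegative terms.\<close>
lemma sum_laplacian_weight:
  fixes f :: "'a \<Rightarrow> real"
  assumes f: "\<And>y. 0 \<le> f y"
  shows "(\<Sum>y | y \<in> V \<and> depth y < R. - laplacian E f y * (1 - barrier (depth y) / barrier R))
    \<ge> - (\<Sum>y | y \<in> V \<and> depth y < R. f y * (barrier (depth y) / barrier R))"
proof -
  define c where "c y = 1 - barrier (depth y) / barrier R" for y
  let ?B = "{y \<in> V. depth y < R}"
  \<comment> \<open>Neighbours of the ball \<open>?B\<close> have depth at most \<open>R\<close>,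
    hence this larger ball.\<close>
  let ?C = "{y \<in> V. depth y < Suc R}"
  have c_nonneg: "0 \<le> c y" if "y \<in> ?C" for y
    using that barrier_mono[of "depth y" R] barrier_pos[of R] by (simp add: c_def field_simps)
  have c_0: "c y = 0" if "depth y = R" for y
    using that barrier_pos[of R] by (simp add: c_def)
  \<comment> \<open>One-sided Green's formula: exchanging the ends of each edge moves the Laplacian
    from \<open>f\<close> to the weight \<open>c\<close>.\<close>
  have "(\<Sum>z\<in>?B. \<Sum>y | adjacent E z y. c y * f z)
      = (\<Sum>z\<in>?B. \<Sum>y | y \<in> ?C \<and> adjacent E y z. c y * f z)"
  proof (intro sum.cong refl)
    fix z assume z: "z \<in> ?B"
    have "depth y < Suc R" if "adjacent E y z" for y
      using depth_adjacent[OF that] z by simp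
    then show "{y. adjacent E z y} = {y. y \<in> ?C \<and> adjacent E y z}"
      by (auto simp: adjacent_commute[of E z] dest: adjacent_in_V)
  qed
  also have "\<dots> = (\<Sum>y\<in>?C. \<Sum>z | z \<in> ?B \<and> adjacent E y z. c y * f z)"
    by (rule sum.swap_restrict[symmetric]) (rule finite_ball)+
  also have "\<dots> \<le> (\<Sum>y\<in>?C. \<Sum>z | adjacent E y z. c y * f z)"
    by (intro sum_mono sum_mono2) (auto intro!: mult_nonneg_nonneg c_nonneg f)
  also have "\<dots> = (\<Sum>y\<in>?B. \<Sum>z | adjacent E y z. c y * f z)"
    by (rule sum.mono_neutral_right[OF finite_ball]) (auto simp: less_Suc_eq c_0)
  finally have swap: "(\<Sum>z\<in>?B. \<Sum>y | adjacent E z y. c y * f z)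
      \<le> (\<Sum>y\<in>?B. \<Sum>z | adjacent E y z. c y * f z)" .
  \<comment> \<open>The constant 1 is harmonic, so only the barrier term survives.\<close>
  have lap: "laplacian E c y = - (laplacian E (\<lambda>z. barrier (depth z)) y / barrier R)" for y
    unfolding laplacian_def c_def by (simp add: sum_divide_distrib diff_divide_distrib flip: sum_negf)
  have "- (f y * (barrier (depth y) / barrier R)) \<le> f y * - laplacian E c y" if "y \<in> ?B" for y
  proof -
    have "- barrier (depth y) / barrier R \<le> laplacian E (\<lambda>z. barrier (depth z)) y / barrier R"
      using that barrier_pos[of R] by (intro divide_right_mono laplacian_barrier) auto
    then have "f y * (- barrier (depth y) / barrier R) \<le> f y * - laplacian E c y"
      unfolding lap by (intro mult_left_mono f) simp
    then show ?thesis by simp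
  qed
  then have "- (\<Sum>y\<in>?B. f y * (barrier (depth y) / barrier R)) \<le> (\<Sum>y\<in>?B. f y * - laplacian E c y)"
    unfolding sum_negf[symmetric] by (rule sum_mono)
  also have "\<dots> = (\<Sum>z\<in>?B. \<Sum>y | adjacent E z y. c y * f z)
      - (\<Sum>y\<in>?B. real (valence E y) * f y * c y)"
    unfolding laplacian_eq
    by (simp add: algebra_simps sum_distrib_left flip: sum_subtractf)
  also have "\<dots> \<le> (\<Sum>y\<in>?B. \<Sum>z | adjacent E y z. c y * f z)
      - (\<Sum>y\<in>?B. real (valence E y) * f y * c y)"
    using swap by simp
  also have "\<dots> = (\<Sum>y\<in>?B. - laplacian E f y * c y)"
    unfolding laplacian_eq
    by (simp add: algebra_simps sum_distrib_left flip: sum_subtractf)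
  finally show ?thesis
    by (simp add: c_def)
qed

text \<open>A Gronwall argument for the weighted mass \<open>F\<close>, started from the unit mass
  at \<open>x\<close>.\<close>

lemma sum_minimal_kernel_ge:
  assumes "x \<in> V" "depth x < R" "0 \<le> t"
  shows "1 - exp t * (barrier (depth x) / barrier R)
    \<le> (\<Sum>y | y \<in> V \<and> depth y < R. minimal_kernel E t x y)"
proof -
  let ?B = "{y \<in> V. depth y < R}"
  let ?p = "minimal_kernel E"
  define c where "c y = 1 - barrier (depth y) / barrier R" for y
  define F where "F s = (\<Sum>y\<in>?B. ?p s x y * c y)" for s
  define F' where "F' s = (\<Sum>y\<in>?B. - laplacian E (?p s x) y * c y)" for s
  \<comment> \<open>With the integrating factor, F' \<ge> F - 1 says that \<open>G\<close> is
    nondecreasing.\<close>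
  define G where "G s = (F s - 1) * exp (- s)" for s
  have F: "(F has_real_derivative F' s) (at s within {0..})" if "0 \<le> s" for s
    unfolding F_def F'_def by (intro DERIV_sum DERIV_cmult_right minimal_kernel_forward that)
  have G: "(G has_real_derivative (F' s - F s + 1) * exp (- s)) (at s within {0..})"
    if "0 \<le> s" for s
    unfolding G_def
    by (rule derivative_eq_intros F that refl)+ (simp add: algebra_simps)
  \<comment> \<open>\<open>sum_laplacian_weight\<close> bounds \<open>F'\<close> below by
    \<open>F\<close> minus the mass in the ball, and that mass is at most 1.\<close>
  have F'_ge: "F s - 1 \<le> F' s" if "0 \<le> s" for s
  proof -
    have "F s - (\<Sum>y\<in>?B. ?p s x y) = - (\<Sum>y\<in>?B. ?p s x y * (barrier (depth y) / barrier R))"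
      unfolding F_def c_def by (simp add: algebra_simps flip: sum_subtractf sum_negf)
    also have "\<dots> \<le> F' s"
      unfolding F'_def c_def by (rule sum_laplacian_weight) (rule minimal_kernel_nonneg[OF that])
    finally show ?thesis
      using sum_minimal_kernel_le_1[OF finite_ball that, of x R] by simp
  qed
  have "G 0 \<le> G t"
  \<comment> \<open>At s > 0 the derivative is two-sided; the endpoint 0 enters by
    continuity.\<close>
  proof (rule DERIV_nonneg_imp_increasing_open[OF \<open>0 \<le> t\<close>])
    fix s :: real assume "0 < s"
    then have "(G has_real_derivative (F' s - F s + 1) * exp (- s)) (at s)"
      using G[of s] by (simp add: at_within_interior[of s "{0..}"])
    moreover have "0 \<le> (F' s - F s + 1) * exp (- s)"
      using F'_ge[of s] \<open>0 < s\<close> by simp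
    ultimately show "\<exists>y. (G has_real_derivative y) (at s) \<and> 0 \<le> y" by blast
  next
    have "continuous_on {0..} G"
      by (rule DERIV_continuous_on) (rule G, simp)
    then show "continuous_on {0..t} G"
      by (rule continuous_on_subset) auto
  qed
  moreover have "G 0 = - (barrier (depth x) / barrier R)"
  proof -
    have "F 0 = (\<Sum>y\<in>?B. if x = y then c y else 0)"
      unfolding F_def minimal_kernel_0 by (intro sum.cong) auto
    also have "\<dots> = c x"
      using assms finite_ball[of R] by simp
    finally show ?thesis by (simp add: G_def c_def)
  qed
  ultimately have "- (barrier (depth x) / barrier R) * exp t \<le> (F t - 1) * exp (- t) * exp t"
    by (intro mult_right_mono) (auto simp: G_def)
  then have "1 - exp t * (barrier (depth x) / barrier R) \<le> F t"
    by (simp add: exp_minus algebra_simps)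
  also have "F t \<le> (\<Sum>y\<in>?B. ?p t x y)"
    unfolding F_def
  proof (rule sum_mono)
    fix y
    have "c y \<le> 1"
      using barrier_pos[of "depth y"] barrier_pos[of R] by (simp add: c_def)
    then show "?p t x y * c y \<le> ?p t x y"
      by (rule mult_left_le) (rule minimal_kernel_nonneg[OF \<open>0 \<le> t\<close>])
  qed
  finally show ?thesis .
qed

lemma stochastically_complete_if_divergent:
  assumes "(\<Sum>r. ennreal (1 / real (max_valence V E x0 r))) = \<infinity>"
  shows "stochastically_complete V E"
  unfolding stochastically_complete_def stochastically_incomplete_def
proof (intro notI, elim bexE exE conjE)
  fix x t assume x: "x \<in> V" and "(0::real) < t"
    and less: "(\<Sum>\<^sub>\<infinity>y\<in>V. ennreal (heat_kernel V E t x y)) < 1"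
  let ?p = "minimal_kernel E"
  have t: "0 \<le> t" using \<open>0 < t\<close> by simp
  \<comment> \<open>A sum below 1 is finite, hence a real number.\<close>
  obtain L where L: "0 \<le> L" "(\<Sum>\<^sub>\<infinity>y\<in>V. ennreal (heat_kernel V E t x y)) = ennreal L" "L < 1"
    using less by (cases "\<Sum>\<^sub>\<infinity>y\<in>V. ennreal (heat_kernel V E t x y)") (auto simp: ennreal_less_one_iff)
  have le_L: "1 - exp t * (barrier (depth x) / barrier R) \<le> L" if "depth x < R" for R
  proof -
    let ?B = "{y \<in> V. depth y < R}"
    have "ennreal (\<Sum>y\<in>?B. ?p t x y) = (\<Sum>y\<in>?B. ennreal (heat_kernel V E t x y))"
      using x t by (simp add: minimal_kernel_nonneg heat_kernel_eq_minimal_kernel flip: sum_ennreal)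
    also have "\<dots> \<le> (\<Sum>\<^sub>\<infinity>y\<in>V. ennreal (heat_kernel V E t x y))"
      \<comment> \<open>With nonnegative terms the infinite sum is the supremum over finite subsets,
        and the ball is one of them.\<close>
      unfolding nonneg_infsum_complete[OF zero_le]
      by (rule SUP_upper) (auto simp: finite_ball)
    finally have "(\<Sum>y\<in>?B. ?p t x y) \<le> L"
      using L by simp
    with sum_minimal_kernel_ge[OF x that t] show ?thesis by simp
  qed
  \<comment> \<open>The radius exceeds \<open>depth x\<close> and is so large that the lower bound
    on the mass exceeds \<open>L\<close>.\<close>
  obtain R where R: "depth x < R" "exp t * barrier (depth x) / (1 - L) < barrier R"
    using barrier_unbounded[OF assms, of "Suc (depth x)"] by (auto simp: Suc_le_eq)
  from R(2) have "exp t * (barrier (depth x) / barrier R) < 1 - L"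
    using L(3) barrier_pos[of R] by (simp add: field_simps)
  with le_L[OF R(1)] show False by simp
qed

end

theorem theorem3p3p4:
  fixes V :: "'a set" and E :: "'a set set" and x0 :: 'a
  assumes "simple_graph V E"
    and "infinite V"
    and "locally_finite_graph V E"
    and "connected_graph V E"
    and "x0 \<in> V"
    and "(\<Sum>r. ennreal (1 / real (max_valence V E x0 r))) = \<infinity>"
  shows "stochastically_complete V E"
proof -
  interpret rooted_connected_graph V E x0
    by unfold_locales (fact assms)+
  show ?thesis
    by (rule stochastically_complete_if_divergent[OF assms(6)])
qed

end
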